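(* Let $(\mathfrak{g},\{J_\alpha\}_{\alpha=1,2,3},g)$ be a hyper-Kähler Lie algebra. Then $\mathfrak{g}$ decomposes orthogonally as $$\mathfrak{g}=\mathfrak{t}\oplus\mathfrak{g}^1,\qquad \mathfrak{z}(\mathfrak{g})\subset\mathfrak{t},$$ with both $\mathfrak{t}$ and $\mathfrak{g}^1$ abelian and $J_\alpha$-invariant, $\alpha=1,2,3$, such that (i) $\mathrm{ad}_XJ_\alpha=J_\alpha\,\mathrm{ad}_X$ for any $X\in\mathfrak{t}$, $\alpha=1,2,3$; (ii) $g(\mathrm{ad}_XY,Z)+g(Y,\mathrm{ad}_XZ)=0$ for any $X\in\mathfrak{t}$, $Y,Z\in\mathfrak{g}$.
   Context: $\mathfrak{g}$ is a finite dimensional real Lie algebra, $\mathfrak{g}^1=[\mathfrak{g},\mathfrak{g}]$ is its commutator ideal and $\mathfrak{z}(\mathfrak{g})$ its center. For an inner product $g$ on $\mathfrak{g}$ the Levi-Civita connection is given by $2g(\nabla_XY,Z)=g([X,Y],Z)-g([Y,Z],X)+g([Z,X],Y)$. A hypercomplex structure on $\mathfrak{g}$ is a triple of endomorphisms $J_1,J_2,J_3$ with $J_\alpha^2=-\mathrm{id}$, $J_1J_2=-J_2J_1=J_3$, and vanishing Nijenhuis tensors $N_\alpha(X,Y)=J_\alpha([X,Y]-[J_\alpha X,J_\alpha Y])-([J_\alpha X,Y]+[X,J_\alpha Y])$. $(\mathfrak{g},\{J_\alpha\},g)$ is a hyper-Kähler Lie algebra if $\{J_\alpha\}$ is a hypercomplex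 structure, $g(J_\alpha X,J_\alpha Y)=g(X,Y)$ for all $X,Y\in\mathfrak{g}$ and all $\alpha$, and $\nabla J_\alpha=0$ for $\alpha=1,2,3$. *)

theory Defs
  imports "HOL-Analysis.Analysis"
begin

(* The bracket [X, Y] is br X Y, so ad_X is the map br X.  The inner product g of a metric Lie
   algebra is the inner product of the type class real_inner; together with finite_dim this covers
   every finite-dimensional inner product space, including the zero space, which euclidean_space
   would exclude. *)

locale fin_dim_lie_algebra =
  fixes br :: "'a::real_vector \<Rightarrow> 'a \<Rightarrow> 'a"
  assumes finite_dim: "\<exists>B::'a set. finite B \<and> span B = UNIV"
    and bilinear_br: "bilinear br"
    and br_self: "\<And>X. br X X = 0"
    and jacobi: "\<And>X Y Z. br X (br Y Z) + br Y (br Z X) + br Z (br X Y) = 0"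

definition commutator_ideal :: "('a::real_vector \<Rightarrow> 'a \<Rightarrow> 'a) \<Rightarrow> 'a set" where
  "commutator_ideal br = span {br X Y | X Y. True}"

definition lie_center :: "('a::real_vector \<Rightarrow> 'a \<Rightarrow> 'a) \<Rightarrow> 'a set" where
  "lie_center br = {X. \<forall>Y. br X Y = 0}"

definition abelian_on :: "('a::real_vector \<Rightarrow> 'a \<Rightarrow> 'a) \<Rightarrow> 'a set \<Rightarrow> bool" where
  "abelian_on br S \<longleftrightarrow> (\<forall>X\<in>S. \<forall>Y\<in>S. br X Y = 0)"

(* The vector determined by the Koszul formula; see levi_civita_koszul below for its existence and
   uniqueness in finite dimension. *)
definition levi_civita :: "('a::real_inner \<Rightarrow> 'a \<Rightarrow> 'a) \<Rightarrow> 'a \<Rightarrow> 'a \<Rightarrow> 'a" where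
  "levi_civita br X Y =
     (THE W. \<forall>Z. 2 * (W \<bullet> Z) = br X Y \<bullet> Z - br Y Z \<bullet> X + br Z X \<bullet> Y)"

definition nijenhuis ::
  "('a::real_vector \<Rightarrow> 'a \<Rightarrow> 'a) \<Rightarrow> ('a \<Rightarrow> 'a) \<Rightarrow> 'a \<Rightarrow> 'a \<Rightarrow> 'a" where
  "nijenhuis br J X Y = J (br X Y - br (J X) (J Y)) - (br (J X) Y + br X (J Y))"

(* The triple J_1, J_2, J_3 is a family J of which only the indices 1, 2, 3 matter. *)
locale hypercomplex_lie_algebra = fin_dim_lie_algebra br
  for br :: "'a::real_vector \<Rightarrow> 'a \<Rightarrow> 'a" +
  fixes J :: "nat \<Rightarrow> 'a \<Rightarrow> 'a"
  assumes linear_J: "\<And>\<alpha>. \<alpha> \<in> {1, 2, 3} \<Longrightarrow> linear (J \<alpha>)"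
    and J_square: "\<And>\<alpha> X. \<alpha> \<in> {1, 2, 3} \<Longrightarrow> J \<alpha> (J \<alpha> X) = - X"
    and J1_J2: "\<And>X. J 1 (J 2 X) = J 3 X"
    and J2_J1: "\<And>X. - J 2 (J 1 X) = J 3 X"
    and nijenhuis_zero: "\<And>\<alpha> X Y. \<alpha> \<in> {1, 2, 3} \<Longrightarrow> nijenhuis br (J \<alpha>) X Y = 0"

(* J_parallel is (nabla_X J) Y = nabla_X (J Y) - J (nabla_X Y) = 0. *)
locale hyper_kaehler_lie_algebra = hypercomplex_lie_algebra br J
  for br :: "'a::real_inner \<Rightarrow> 'a \<Rightarrow> 'a" and J :: "nat \<Rightarrow> 'a \<Rightarrow> 'a" +
  assumes J_isometric: "\<And>\<alpha> X Y. \<alpha> \<in> {1, 2, 3} \<Longrightarrow> J \<alpha> X \<bullet> J \<alpha> Y = X \<bullet> Y"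
    and J_parallel: "\<And>\<alpha> X Y. \<alpha> \<in> {1, 2, 3} \<Longrightarrow>
          levi_civita br X (J \<alpha> Y) - J \<alpha> (levi_civita br X Y) = 0"

lemma riesz_finite_dim:
  fixes f :: "'a::real_inner \<Rightarrow> real"
  assumes fin: "\<exists>B::'a set. finite B \<and> span B = UNIV" and lin: "linear f"
  shows "\<exists>!W. \<forall>Z. W \<bullet> Z = f Z"
proof -
  obtain B :: "'a set" where B: "finite B" "span B = UNIV"
    using fin by blast
  obtain C where C: "finite C" "span C = span B" "pairwise orthogonal C"
    using basis_orthogonal[OF B(1)] by blast
  define W where "W = (\<Sum>b\<in>C. (f b / (b \<bullet> b)) *\<^sub>R b)"
  have W_basis: "W \<bullet> c = f c" if c: "c \<in> C" for c
  proof -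
    have "W \<bullet> c = (\<Sum>b\<in>C. f b / (b \<bullet> b) * (b \<bullet> c))"
      by (simp add: W_def inner_sum_left)
    also have "\<dots> = (\<Sum>b\<in>C. if b = c then f c else 0)"
    proof (rule sum.cong)
      fix b assume b: "b \<in> C"
      show "f b / (b \<bullet> b) * (b \<bullet> c) = (if b = c then f c else 0)"
      proof (cases "b = c")
        case True
        then show ?thesis using linear_0[OF lin] by (cases "c = 0") auto
      next
        case False
        then have "b \<bullet> c = 0"
          using C(3) b c by (auto simp: pairwise_def orthogonal_def)
        then show ?thesis using False by simp
      qed
    qed simp
    also have "\<dots> = f c" using C(1) c by simp
    finally show ?thesis .
  qed
  have "linear (\<lambda>Z. W \<bullet> Z)"
    by (simp add: bounded_linear.linear bounded_linear_inner_right)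
  then have W: "W \<bullet> Z = f Z" for Z
    using linear_eq_on_span[of "\<lambda>Z. W \<bullet> Z" f C Z] lin W_basis B(2) C(2) by auto
  show ?thesis
  proof (rule ex1I[of _ W])
    show "\<forall>Z. W \<bullet> Z = f Z" using W by simp
    fix V assume V: "\<forall>Z. V \<bullet> Z = f Z"
    have "(V - W) \<bullet> (V - W) = 0"
      unfolding inner_diff_left using V W by simp
    then show "V = W" by simp
  qed
qed

lemma levi_civita_koszul:
  fixes br :: "'a::real_inner \<Rightarrow> 'a \<Rightarrow> 'a"
  assumes "fin_dim_lie_algebra br"
  shows "2 * (levi_civita br X Y \<bullet> Z) = br X Y \<bullet> Z - br Y Z \<bullet> X + br Z X \<bullet> Y"
    and "\<And>W. (\<And>Z. 2 * (W \<bullet> Z) = br X Y \<bullet> Z - br Y Z \<bullet> X + br Z X \<bullet> Y) \<Longrightarrow>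
           W = levi_civita br X Y"
proof -
  interpret fin_dim_lie_algebra br by fact
  define f where "f = (\<lambda>Z. (br X Y \<bullet> Z - br Y Z \<bullet> X + br Z X \<bullet> Y) / 2)"
  have "linear f"
    by (rule linearI)
       (simp_all add: f_def bilinear_radd[OF bilinear_br] bilinear_ladd[OF bilinear_br]
          bilinear_rmul[OF bilinear_br] bilinear_lmul[OF bilinear_br] inner_add
          field_simps)
  from riesz_finite_dim[OF finite_dim this]
  have ex1: "\<exists>!W. \<forall>Z. 2 * (W \<bullet> Z) = br X Y \<bullet> Z - br Y Z \<bullet> X + br Z X \<bullet> Y"
    by (simp add: f_def field_simps)
  show "2 * (levi_civita br X Y \<bullet> Z) = br X Y \<bullet> Z - br Y Z \<bullet> X + br Z X \<bullet> Y"
    using theI'[OF ex1] unfolding levi_civita_def by blast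
  show "W = levi_civita br X Y"
    if "\<And>Z. 2 * (W \<bullet> Z) = br X Y \<bullet> Z - br Y Z \<bullet> X + br Z X \<bullet> Y" for W
    unfolding levi_civita_def using the1_equality[OF ex1] that by blast
qed

end

theory Submission
  imports Defs
begin

text \<open>
Write \<open>A X = \<nabla>\<^sub>X\<close> for the Levi-Civita connection form and \<open>R\<close> for its curvature. The subspace sought is the
space of parallel vectors \<open>t = {X. \<forall>Y. A Y X = 0}\<close>, and the proof rests on four observations.

\<^item> \<^emph>\<open>Ricci-flatness.\<close> Since \<open>R X Y\<close> commutes with \<open>J\<^sub>1\<close> and \<open>J\<^sub>2\<close>, the endomorphism \<open>J\<^sub>1 \<circ> R X Y\<close>
  anticommutes with \<open>J\<^sub>2\<close> and so has trace zero (\<open>tr_J_curv\<close>). This says that the Ricci form of the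
  Kaehler structure \<open>J\<^sub>1\<close> vanishes.

\<^item> \<^emph>\<open>Parallel vectors.\<close> Let \<open>\<rho>\<^sub>X = (\<lambda>Y. A Y X)\<close> and let \<open>v\<close> be the vector with
  \<open>tr \<rho>\<^sub>X = - (X \<bullet> v)\<close>. Contracting the curvature, \<open>Ric = 0\<close> reads \<open>tr (\<rho>\<^sub>X \<circ> \<rho>\<^sub>Z) = \<rho>\<^sub>v Z \<bullet> X\<close>. The left
  side is symmetric, so \<open>\<rho>\<^sub>v\<close> is symmetric with \<open>|\<rho>\<^sub>v|\<^sup>2 = tr (\<rho>\<^sub>v \<circ> \<rho>\<^sub>v) = \<rho>\<^sub>v v \<bullet> v = 0\<close>; then \<open>v\<close> vanishes too.
  Hence the algebra is unimodular and \<open>tr (\<rho>\<^sub>X \<circ> \<rho>\<^sub>Z) = 0\<close> for all \<open>X\<close>, \<open>Z\<close>: every \<open>\<rho>\<^sub>X\<close> that is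
  symmetric or skew is zero. It is symmetric exactly when \<open>X\<close> is orthogonal to the commutator ideal,
  and skew when \<open>X\<close> is central. So \<open>t\<close> is the orthogonal complement of the commutator ideal and
  contains the center. On \<open>t\<close> one has \<open>ad X = A X\<close>, which is skew and commutes with every \<open>J\<^sub>\<alpha>\<close>.

\<^item> \<^emph>\<open>Flatness.\<close> A left-invariant metric that is Kaehler and Ricci-flat is flat
  (\<open>curvature_vanishes\<close>). The tangent bundle is trivialised by left-invariant fields, so the
  4-form \<open>tr (R \<and> R)\<close> is the differential of a left-invariant Chern-Simons form, and by
  unimodularity its contraction with the parallel bivector \<open>\<omega> \<and> \<omega>\<close> is the divergence of a
  left-invariant vector field, namely zero. On the other hand \<open>R\<close> is of type (1,1) with vanishing
  Ricci form, which makes the same contraction a nonzero multiple of \<open>|R|\<^sup>2\<close>. The lemmas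
  \<open>quartic_alternating\<close>, \<open>cubic\<close> and \<open>quadratic\<close> carry this out in coordinates.

\<^item> \<^emph>\<open>The commutator ideal.\<close> By flatness \<open>A\<close> is an orthogonal representation. On the complement \<open>W\<close> of
  its kernel the form \<open>- tr (A X \<circ> A Y)\<close> is positive definite and invariant, and the Casimir
  operator \<open>C = \<Sum> A f \<circ> A f\<close> built from it satisfies \<open>C Y = A Y p = \<rho>\<^sub>p Y\<close> with \<open>p = \<Sum> A f f\<close>.
  Unimodularity gives trace zero to \<open>\<rho>\<^sub>p\<close>, hence to \<open>C\<close> on \<open>W\<close>. But \<open>C\<close> is negative semidefinite, so it
  vanishes on \<open>W\<close>, and \<open>W\<close> consists of parallel vectors. Therefore the commutator ideal, being
  orthogonal to \<open>t\<close>, is orthogonal to \<open>W\<close> and lies in the kernel of \<open>A\<close>, where the bracket vanishes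
  (\<open>A_commutator_ideal_zero\<close>).
\<close>

section \<open>Frames, projections and traces\<close>

text \<open>Gram-Schmidt for a positive semidefinite form: vectors on which the form degenerates are simply
dropped. It is used for the inner product itself and for the trace form of the connection, which
is only semidefinite on the whole algebra.\<close>

lemma semi_inner_frame_exists:
  fixes Q :: "'a::real_vector \<Rightarrow> 'a \<Rightarrow> real"
  assumes bil: "bilinear Q" and sym: "\<And>x y. Q x y = Q y x" and pos: "\<And>x. Q x x \<ge> 0"
    and null: "\<And>x y. Q x x = 0 \<Longrightarrow> Q x y = 0" and fin: "finite B"
  shows "\<exists>F. finite F \<and> F \<subseteq> span B \<and> (\<forall>x\<in>span B. \<forall>y. Q x y = (\<Sum>f\<in>F. Q x f * Q f y))"
  using fin
proof (induction B rule: finite_induct)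
  case empty
  show ?case using bilinear_lzero[OF bil] by (intro exI[of _ "{}"]) auto
next
  case (insert b B)
  note Qs = bilinear_ladd[OF bil] bilinear_radd[OF bil] bilinear_lmul[OF bil] bilinear_rmul[OF bil]
    bilinear_lsub[OF bil] bilinear_rsub[OF bil]
  obtain F where F: "finite F" "F \<subseteq> span B"
    and ex: "\<And>x y. x \<in> span B \<Longrightarrow> Q x y = (\<Sum>f\<in>F. Q x f * Q f y)"
    using insert.IH by blast
  have linQ: "linear (\<lambda>x. Q x y)" for y using bil by (simp add: bilinear_def)
  \<comment> \<open>the part of \<open>b\<close> that is orthogonal to the span of the frame constructed so far\<close>
  define c where "c = b - (\<Sum>f\<in>F. Q b f *\<^sub>R f)"
  have Qc: "Q c y = Q b y - (\<Sum>f\<in>F. Q b f * Q f y)" for y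
    by (simp add: c_def Qs linear_sum[OF linQ])
  have c_perp: "Q c y = 0" if "y \<in> span B" for y
    using ex[OF that, of b] by (simp add: Qc sym mult.commute)
  have span_sub: "span B \<subseteq> span (insert b B)" by (simp add: span_mono subset_insertI)
  have "(\<Sum>f\<in>F. Q b f *\<^sub>R f) \<in> span B" using F(2) by (intro span_sum span_scale) auto
  then have c_span: "c \<in> span (insert b B)"
    unfolding c_def using span_sub by (intro span_diff) (auto intro: span_base)
  have split: "\<exists>s y. y \<in> span B \<and> x = y + s *\<^sub>R c" if x: "x \<in> span (insert b B)" for x
  proof -
    obtain s where s: "x - s *\<^sub>R b \<in> span B" using x span_breakdown_eq by blast
    have "x - s *\<^sub>R c = (x - s *\<^sub>R b) + s *\<^sub>R (\<Sum>f\<in>F. Q b f *\<^sub>R f)"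
      by (simp add: c_def algebra_simps)
    then have "x - s *\<^sub>R c \<in> span B"
      using s \<open>(\<Sum>f\<in>F. Q b f *\<^sub>R f) \<in> span B\<close> by (metis span_add span_scale)
    then show ?thesis by (metis diff_add_cancel)
  qed
  show ?case
  proof (cases "Q c c = 0")
    case True
    have "Q x y = (\<Sum>f\<in>F. Q x f * Q f y)" if x: "x \<in> span (insert b B)" for x y
    proof -
      obtain s z where "z \<in> span B" "x = z + s *\<^sub>R c" using split[OF x] by blast
      then show ?thesis using ex null[OF True] by (simp add: Qs)
    qed
    then show ?thesis using F span_sub by (intro exI[of _ F]) auto
  next
    case False
    define d where "d = (1 / sqrt (Q c c)) *\<^sub>R c"
    have d_perp: "Q d f = 0" "Q f d = 0" if "f \<in> F" for f
      using c_perp[of f] F(2) that by (auto simp: d_def Qs sym[of f])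
    have "Q d d = 1" using False pos[of c] by (simp add: d_def Qs)
    then have d_notin: "d \<notin> F" using d_perp by fastforce
    have Qcd: "Q c d * Q d y = Q c y" for y
      using False pos[of c] by (simp add: d_def Qs)
    have "Q x y = (\<Sum>f\<in>insert d F. Q x f * Q f y)" if x: "x \<in> span (insert b B)" for x y
    proof -
      obtain s z where z: "z \<in> span B" "x = z + s *\<^sub>R c" using split[OF x] by blast
      have "Q z d = 0" using c_perp[OF z(1)] by (simp add: d_def Qs sym)
      have "(\<Sum>f\<in>F. Q x f * Q f y) = (\<Sum>f\<in>F. Q z f * Q f y)"
        using c_perp F(2) by (intro sum.cong) (auto simp: z(2) Qs)
      moreover have "Q x d * Q d y = s * Q c y"
        using \<open>Q z d = 0\<close> Qcd[of y] by (simp add: z(2) Qs)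
      ultimately show ?thesis
        using F(1) d_notin ex[OF z(1), of y] by (simp add: z(2) Qs)
    qed
    moreover have "d \<in> span (insert b B)" using c_span by (simp add: d_def span_scale)
    ultimately show ?thesis using F span_sub by (intro exI[of _ "insert d F"]) auto
  qed
qed

lemma finite_dim_subspace_spanned:
  fixes S :: "'a::real_vector set"
  assumes fin: "\<exists>B::'a set. finite B \<and> span B = UNIV" and sub: "subspace S"
  obtains B where "finite B" "span B = S"
proof -
  obtain C :: "'a set" where C: "finite C" "span C = UNIV" using fin by blast
  obtain B where B: "B \<subseteq> S" "independent B" "S \<subseteq> span B" using basis_exists[of S] by metis
  have "finite B" using independent_span_bound[OF C(1) B(2)] C(2) by simp
  moreover have "span B = S" using B sub span_minimal by blast
  ultimately show ?thesis using that by blast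
qed

lemma bilinear_inner: "bilinear (\<lambda>x y::'a::real_inner. x \<bullet> y)"
  by (simp add: bilinear_def linear_iff inner_add)

lemma parseval_frame_exists:
  fixes S :: "'a::real_inner set"
  assumes fin: "\<exists>B::'a set. finite B \<and> span B = UNIV" and sub: "subspace S"
  obtains F where "finite F" "F \<subseteq> S" "\<forall>x\<in>S. \<forall>y. x \<bullet> y = (\<Sum>f\<in>F. (x \<bullet> f) * (f \<bullet> y))"
proof -
  obtain B where B: "finite B" "span B = S" using finite_dim_subspace_spanned[OF fin sub] .
  obtain F where F: "finite F" "F \<subseteq> span B"
    and ex: "\<forall>x\<in>span B. \<forall>y. x \<bullet> y = (\<Sum>f\<in>F. (x \<bullet> f) * (f \<bullet> y))"
    using semi_inner_frame_exists[OF bilinear_inner, of B] B(1) by (auto simp: inner_commute)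
  show ?thesis
  proof (rule that)
    show "finite F" "F \<subseteq> S" using F B(2) by auto
    show "\<forall>x\<in>S. \<forall>y. x \<bullet> y = (\<Sum>f\<in>F. (x \<bullet> f) * (f \<bullet> y))"
      using ex unfolding B(2) .
  qed
qed

lemma orthogonal_decomposition:
  fixes S :: "'a::real_inner set"
  assumes "\<exists>B::'a set. finite B \<and> span B = UNIV" and "subspace S"
  obtains y z where "x = y + z" "y \<in> S" "\<forall>w\<in>S. z \<bullet> w = 0"
proof -
  obtain F where F: "finite F" "F \<subseteq> S"
    and ex: "\<forall>x\<in>S. \<forall>y. x \<bullet> y = (\<Sum>f\<in>F. (x \<bullet> f) * (f \<bullet> y))"
    by (rule parseval_frame_exists[OF assms])
  define y where "y = (\<Sum>f\<in>F. (x \<bullet> f) *\<^sub>R f)"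
  show ?thesis
  proof (rule that[of y "x - y"])
    show "y \<in> S" unfolding y_def using F assms(2) by (auto intro!: subspace_sum subspace_scale)
    show "\<forall>w\<in>S. (x - y) \<bullet> w = 0"
    proof
      fix w assume w: "w \<in> S"
      have "y \<bullet> w = (\<Sum>f\<in>F. (w \<bullet> f) * (f \<bullet> x))"
        unfolding y_def inner_sum_left
        by (intro sum.cong refl) (simp add: inner_commute mult.commute)
      also have "\<dots> = w \<bullet> x" by (rule ex[rule_format, OF w, symmetric])
      finally show "(x - y) \<bullet> w = 0" by (simp add: inner_diff_left inner_commute[of x w])
    qed
  qed simp
qed

text \<open>A finite set satisfying Parseval's identity plays the part of an orthonormal basis: the identity
makes the frame trace cyclic and lets vectors be expanded in the frame.\<close>

locale parseval_frame =
  fixes E :: "'a::real_inner set"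
  assumes finite_E: "finite E" and parseval: "\<And>x y. x \<bullet> y = (\<Sum>e\<in>E. (x \<bullet> e) * (e \<bullet> y))"
begin

definition tr :: "('a \<Rightarrow> 'a) \<Rightarrow> real" where
  "tr T = (\<Sum>e\<in>E. T e \<bullet> e)"

lemma tr_lin:
  "tr (\<lambda>x. f x + g x) = tr f + tr g" "tr (\<lambda>x. f x - g x) = tr f - tr g"
  "tr (\<lambda>x. - f x) = - tr f" "tr (\<lambda>x. c *\<^sub>R f x) = c * tr f"
  by (simp_all add: tr_def inner_add_left inner_diff_left sum.distrib sum_subtractf sum_negf
      sum_distrib_left)

lemma expansion: "(\<Sum>e\<in>E. (x \<bullet> e) *\<^sub>R e) = x"
proof -
  have "(\<Sum>e\<in>E. (x \<bullet> e) *\<^sub>R e) \<bullet> y = x \<bullet> y" for y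
    by (simp add: inner_sum_left parseval[of x y])
  then show ?thesis using vector_eq_rdot by blast
qed

lemma linear_expansion:
  assumes "linear T" shows "T x = (\<Sum>e\<in>E. (x \<bullet> e) *\<^sub>R T e)"
  by (subst expansion[of x, symmetric]) (simp add: linear_sum[OF assms] linear_scale[OF assms])

lemma linear_zero_on_frame:
  assumes "linear T" "\<And>e. e \<in> E \<Longrightarrow> T e = 0" shows "T x = 0"
  using linear_expansion[OF assms(1), of x] assms(2) by simp

text \<open>The tensor \<open>\<Sum> e \<otimes> e\<close> does not depend on the frame, so an endomorphism acting on one factor can be
moved to the other one as its adjoint. Below this is applied to the skew maps \<open>A X\<close> and \<open>I\<close>.\<close>

lemma sum_adjoint:
  fixes f :: "'a \<Rightarrow> 'a \<Rightarrow> 'b::real_vector"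
  assumes bil: "bilinear f" and adj: "\<And>x y. T x \<bullet> y = x \<bullet> T' y"
  shows "(\<Sum>e\<in>E. f (T e) e) = (\<Sum>e\<in>E. f e (T' e))"
proof -
  have l: "linear (\<lambda>x. f x y)" and r: "linear (f y)" for y using bil by (auto simp: bilinear_def)
  have adj': "T e \<bullet> d = T' d \<bullet> e" for e d
    using adj[of e d] inner_commute[of e "T' d"] by simp
  have "(\<Sum>e\<in>E. f (T e) e) = (\<Sum>e\<in>E. \<Sum>d\<in>E. (T e \<bullet> d) *\<^sub>R f d e)"
    by (intro sum.cong refl linear_expansion[OF l])
  also have "\<dots> = (\<Sum>d\<in>E. \<Sum>e\<in>E. (T' d \<bullet> e) *\<^sub>R f d e)"
    unfolding adj' by (rule sum.swap)
  also have "\<dots> = (\<Sum>d\<in>E. f d (T' d))"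
    by (intro sum.cong refl linear_expansion[OF r, symmetric])
  finally show ?thesis .
qed

lemma sum_skew:
  fixes f :: "'a \<Rightarrow> 'a \<Rightarrow> 'b::real_vector"
  assumes bil: "bilinear f" and skew: "\<And>x y. T x \<bullet> y = - (x \<bullet> T y)"
  shows "(\<Sum>e\<in>E. f (T e) e) = - (\<Sum>e\<in>E. f e (T e))"
proof -
  have "(\<Sum>e\<in>E. f (T e) e) = (\<Sum>e\<in>E. f e (- T e))"
    by (rule sum_adjoint[OF bil]) (simp add: skew)
  then show ?thesis by (simp add: bilinear_rneg[OF bil] sum_negf)
qed

text \<open>Conjugation by the orthogonal map \<open>K\<close> preserves the trace but changes the sign of \<open>S\<close>.\<close>

lemma tr_zero_if_anticommuting:
  assumes lin: "linear S" "linear K" and square: "\<And>x. K (K x) = - x"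
    and skew: "\<And>x y. K x \<bullet> y = - (x \<bullet> K y)" and anti: "\<And>x. S (K x) = - K (S x)"
  shows "tr S = 0"
proof -
  have "bilinear (\<lambda>x y. S x \<bullet> K y)"
    by (simp add: bilinear_def linear_iff linear_add[OF lin(1)] linear_add[OF lin(2)]
        linear_scale[OF lin(1)] linear_scale[OF lin(2)] inner_add_left inner_add_right)
  from sum_skew[OF this skew] have "(\<Sum>e\<in>E. S (K e) \<bullet> K e) = tr S"
    by (simp add: square tr_def sum_negf)
  moreover have "S (K e) \<bullet> K e = - (S e \<bullet> e)" for e
    using skew[of "S e" "K e"] by (simp add: anti square)
  ultimately show ?thesis by (simp add: tr_def sum_negf)
qed

lemma tr_cyclic:
  assumes "linear S" "linear T"
  shows "tr (\<lambda>x. S (T x)) = tr (\<lambda>x. T (S x))"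
proof -
  have lin: "linear (\<lambda>x. S x \<bullet> y)" "linear (\<lambda>x. T x \<bullet> y)" for y
    using assms by (auto simp: linear_iff inner_add_left)
  have S: "S (T e) \<bullet> e = (\<Sum>d\<in>E. (T e \<bullet> d) * (S d \<bullet> e))" for e
    using linear_expansion[OF lin(1), of "T e" e] by (simp only: real_scaleR_def)
  have T: "T (S d) \<bullet> d = (\<Sum>e\<in>E. (S d \<bullet> e) * (T e \<bullet> d))" for d
    using linear_expansion[OF lin(2), of "S d" d] by (simp only: real_scaleR_def)
  have "tr (\<lambda>x. S (T x)) = (\<Sum>e\<in>E. \<Sum>d\<in>E. (T e \<bullet> d) * (S d \<bullet> e))"
    unfolding tr_def by (simp only: S)
  also have "\<dots> = (\<Sum>d\<in>E. \<Sum>e\<in>E. (S d \<bullet> e) * (T e \<bullet> d))"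
    by (subst sum.swap) (simp add: mult.commute)
  also have "\<dots> = tr (\<lambda>x. T (S x))"
    unfolding tr_def by (simp only: T)
  finally show ?thesis .
qed

lemma tr_square_symmetric:
  assumes "\<And>x y. T x \<bullet> y = x \<bullet> T y" shows "tr (\<lambda>x. T (T x)) = (\<Sum>e\<in>E. T e \<bullet> T e)"
  unfolding tr_def by (simp add: assms)

lemma tr_square_skew:
  assumes "\<And>x y. T x \<bullet> y = - (x \<bullet> T y)" shows "tr (\<lambda>x. T (T x)) = - (\<Sum>e\<in>E. T e \<bullet> T e)"
proof -
  have "T (T e) \<bullet> e = - (T e \<bullet> T e)" for e by (rule assms)
  then show ?thesis unfolding tr_def by (simp add: sum_negf)
qed

lemma sum_squares_zero:
  assumes "linear T" "(\<Sum>e\<in>E. T e \<bullet> T e) = 0" shows "T x = 0"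
proof -
  have "\<forall>e\<in>E. T e \<bullet> T e = 0" using assms(2) finite_E by (subst (asm) sum_nonneg_eq_0_iff) auto
  then show ?thesis using linear_zero_on_frame[OF assms(1)] by simp
qed

end

section \<open>Ricci-flat metric Lie algebras\<close>

text \<open>The connection form \<open>A X\<close> is the covariant derivative in direction \<open>X\<close>, acting on left-invariant
fields.\<close>

locale metric_lie_algebra_frame = fin_dim_lie_algebra br + parseval_frame E
  for br :: "'a::real_inner \<Rightarrow> 'a \<Rightarrow> 'a" and E :: "'a set"
begin

abbreviation A :: "'a \<Rightarrow> 'a \<Rightarrow> 'a" where "A \<equiv> levi_civita br"

definition curv :: "'a \<Rightarrow> 'a \<Rightarrow> 'a \<Rightarrow> 'a" where
  "curv X Y Z = A X (A Y Z) - A Y (A X Z) - A (br X Y) Z"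

lemmas br_lin = bilinear_ladd[OF bilinear_br] bilinear_radd[OF bilinear_br]
  bilinear_lmul[OF bilinear_br] bilinear_rmul[OF bilinear_br]
  bilinear_lneg[OF bilinear_br] bilinear_rneg[OF bilinear_br]
  bilinear_lsub[OF bilinear_br] bilinear_rsub[OF bilinear_br]
  bilinear_lzero[OF bilinear_br] bilinear_rzero[OF bilinear_br]

lemma br_skew: "br Y X = - br X Y"
proof -
  have "br (X + Y) (X + Y) = br Y X + br X Y" unfolding br_lin(1,2) by (simp add: br_self)
  then have "br Y X + br X Y = 0" using br_self[of "X + Y"] by simp
  then show ?thesis by (simp add: eq_neg_iff_add_eq_0)
qed

lemmas koszul = levi_civita_koszul(1)[OF fin_dim_lie_algebra_axioms]

lemma bilinear_A: "bilinear A"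
proof -
  have half: "A X Y \<bullet> Z = (br X Y \<bullet> Z - br Y Z \<bullet> X + br Z X \<bullet> Y) / 2" for X Y Z
    using koszul[of X Y Z] by simp
  have "(A (X + Y) Z) \<bullet> W = (A X Z + A Y Z) \<bullet> W" "(A Z (X + Y)) \<bullet> W = (A Z X + A Z Y) \<bullet> W"
    "A (c *\<^sub>R X) Z \<bullet> W = (c *\<^sub>R A X Z) \<bullet> W" "A Z (c *\<^sub>R X) \<bullet> W = (c *\<^sub>R A Z X) \<bullet> W" for X Y Z W c
    by (simp_all add: half br_lin inner_add_left inner_add_right field_simps)
  then show ?thesis
    unfolding bilinear_def linear_iff using vector_eq_rdot by metis
qed

lemmas A_lin = bilinear_ladd[OF bilinear_A] bilinear_radd[OF bilinear_A]
  bilinear_lmul[OF bilinear_A] bilinear_rmul[OF bilinear_A]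
  bilinear_lneg[OF bilinear_A] bilinear_rneg[OF bilinear_A]
  bilinear_lsub[OF bilinear_A] bilinear_rsub[OF bilinear_A]
  bilinear_lzero[OF bilinear_A] bilinear_rzero[OF bilinear_A]

lemma linear_A [intro, simp]: "linear (A X)" "linear (\<lambda>Z. A Z X)"
  using bilinear_A by (auto simp: bilinear_def)

lemma linear_A_comp [intro, simp]:
  "linear (\<lambda>x. A X (A Y x))" "linear (\<lambda>x. A X (A Y (A Z x)))"
  by (simp_all add: linear_iff A_lin)

lemma A_sum: "A X (sum f I) = (\<Sum>i\<in>I. A X (f i))" "A (sum f I) X = (\<Sum>i\<in>I. A (f i) X)"
  using linear_sum[OF linear_A(1)] linear_sum[OF linear_A(2)] by auto

lemma A_skew: "A X Y \<bullet> Z = - (Y \<bullet> A X Z)"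
  using koszul[of X Y Z] koszul[of X Z Y] br_skew[of Y X] br_skew[of Z Y] br_skew[of Z X]
  by (simp add: inner_commute)

lemma A_torsion_free: "br X Y = A X Y - A Y X"
proof -
  have "br X Y \<bullet> Z = (A X Y - A Y X) \<bullet> Z" for Z
    using koszul[of X Y Z] koszul[of Y X Z] br_skew[of Y X] br_skew[of Z Y] br_skew[of Z X]
    by (simp add: inner_diff_left)
  then show ?thesis using vector_eq_rdot by blast
qed

lemma curv_lin:
  "curv (X + Y) Z W = curv X Z W + curv Y Z W" "curv X (Y + Z) W = curv X Y W + curv X Z W"
  "curv X Y (Z + W) = curv X Y Z + curv X Y W" "curv (c *\<^sub>R X) Y Z = c *\<^sub>R curv X Y Z"
  "curv X (c *\<^sub>R Y) Z = c *\<^sub>R curv X Y Z" "curv X Y (c *\<^sub>R Z) = c *\<^sub>R curv X Y Z"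
  "curv (- X) Y Z = - curv X Y Z" "curv X (- Y) Z = - curv X Y Z" "curv X Y (- Z) = - curv X Y Z"
  by (simp_all add: curv_def A_lin br_lin algebra_simps)

lemma curv_antisym: "curv Y X Z = - curv X Y Z"
  by (simp add: curv_def br_skew[of Y X] A_lin)

lemma curv_skew: "curv X Y Z \<bullet> W = - (Z \<bullet> curv X Y W)"
  by (simp add: curv_def inner_diff_left inner_diff_right A_skew)

lemma bianchi: "curv X Y Z + curv Y Z X + curv Z X Y = 0"
proof -
  have "curv X Y Z + curv Y Z X + curv Z X Y = br X (br Y Z) + br Y (br Z X) + br Z (br X Y)"
    by (simp add: curv_def A_torsion_free A_lin)
  then show ?thesis by (simp add: jacobi)
qed

text \<open>The usual octahedron argument: the four cyclic identities for \<open>(X, Y, Z, W)\<close> are combined, using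
that \<open>R\<close> is skew in each of its two pairs of arguments.\<close>

lemma curv_pair_symmetry: "curv X Y Z \<bullet> W = curv Z W X \<bullet> Y"
proof -
  have b: "curv X Y Z \<bullet> W + curv Y Z X \<bullet> W + curv Z X Y \<bullet> W = 0" for X Y Z W
    using arg_cong[OF bianchi, of "\<lambda>V. V \<bullet> W" X Y Z] by (simp add: inner_add_left)
  have a: "curv X Y Z \<bullet> W = - (curv Y X Z \<bullet> W)" for X Y Z W
    by (simp add: curv_antisym[of Y X])
  have s: "curv X Y Z \<bullet> W = - (curv X Y W \<bullet> Z)" for X Y Z W
    using curv_skew[of X Y Z W] by (simp add: inner_commute)
  show ?thesis
    using b[of X Y Z W] b[of Y Z W X] b[of Z W X Y] b[of W X Y Z]
      a[of X Y Z W] a[of Z W X Y] s[of X Y Z W] s[of Z W X Y]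
      a[of Y Z X W] s[of Y Z X W] a[of Z X Y W] s[of Z X Y W] a[of Y Z W X] a[of Z W Y X]
      s[of Z W Y X] a[of W Y Z X] s[of W Y Z X] a[of W X Z Y] s[of W X Z Y] a[of X Z W Y]
      s[of X Z W Y] s[of W X Y Z] a[of W X Y Z] a[of X Y W Z] s[of X Y W Z] a[of Y W X Z]
      s[of Y W X Z] a[of Z X W Y] a[of W Y X Z]
    by linarith
qed

end

text \<open>The contraction is the Ricci tensor up to sign, because \<open>curv e Z\<close> is skew.\<close>

locale ricci_flat_lie_algebra = metric_lie_algebra_frame +
  assumes ricci_flat: "(\<Sum>e\<in>E. curv e Z e) = 0"
begin

lemma tr_right_mult: "tr (\<lambda>Z. A Z X) = - (X \<bullet> (\<Sum>e\<in>E. A e e))"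
  by (simp add: tr_def A_skew inner_sum_right sum_negf)

text \<open>This is the Ricci tensor written in terms of \<open>A\<close>. The terms \<open>A e (A Z e)\<close> and \<open>A (A Z e) e\<close> of the
contracted curvature cancel because \<open>A Z\<close> is skew.\<close>

lemma sum_A_A: "(\<Sum>e\<in>E. A (A e Z) e) = - A Z (\<Sum>e\<in>E. A e e)"
proof -
  have "(\<Sum>e\<in>E. A (A Z e) e) = - (\<Sum>e\<in>E. A e (A Z e))"
    by (rule sum_skew[OF bilinear_A A_skew])
  moreover have "curv e Z e = A e (A Z e) - A Z (A e e) - A (A e Z) e + A (A Z e) e" for e
    by (simp add: curv_def A_torsion_free A_lin)
  ultimately have "(\<Sum>e\<in>E. curv e Z e) = - A Z (\<Sum>e\<in>E. A e e) - (\<Sum>e\<in>E. A (A e Z) e)"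
    by (simp only: sum.distrib sum_subtractf A_sum) simp
  then show ?thesis using ricci_flat[of Z] by (simp add: eq_neg_iff_add_eq_0)
qed

lemma tr_right_mult_square: "tr (\<lambda>Y. A (A Y Z) X) = A Z (\<Sum>e\<in>E. A e e) \<bullet> X"
proof -
  have "tr (\<lambda>Y. A (A Y Z) X) = - ((\<Sum>e\<in>E. A (A e Z) e) \<bullet> X)"
    unfolding tr_def inner_sum_left by (subst A_skew) (simp add: inner_commute sum_negf)
  then show ?thesis by (simp add: sum_A_A)
qed

text \<open>The vector \<open>v = \<Sum> A e e\<close> represents the trace of the adjoint representation:
\<open>tr (ad X) = - tr (\<lambda>Y. A Y X) = X \<bullet> v\<close>. Applying \<open>tr_right_mult_square\<close> to \<open>v\<close> itself shows that
\<open>Y \<mapsto> A Y v\<close> is symmetric and that its square has trace \<open>A v v \<bullet> v = 0\<close>.\<close>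

lemma unimodular: "(\<Sum>e\<in>E. A e e) = 0"
proof -
  define v where "v = (\<Sum>e\<in>E. A e e)"
  have sq: "tr (\<lambda>Y. A (A Y Z) X) = A Z v \<bullet> X" for X Z
    unfolding v_def by (rule tr_right_mult_square)
  have sym: "A X v \<bullet> Y = X \<bullet> A Y v" for X Y
    using tr_cyclic[OF linear_A(2)[of X] linear_A(2)[of Y]] sq[of X Y] sq[of Y X]
    by (simp add: inner_commute)
  have "(\<Sum>e\<in>E. A e v \<bullet> A e v) = A v v \<bullet> v"
    using tr_square_symmetric[of "\<lambda>X. A X v", OF sym] sq[of v v] by simp
  also have "\<dots> = 0" using A_skew[of v v v] by (simp add: inner_commute)
  finally have "A X v = 0" for X by (rule sum_squares_zero[OF linear_A(2)])
  then have "v \<bullet> v = 0" using tr_right_mult[of v] by (simp add: tr_def v_def)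
  then show ?thesis by (simp add: v_def)
qed

lemma tr_right_mult_zero: "tr (\<lambda>Z. A Z X) = 0"
  by (simp add: tr_right_mult unimodular)

lemma tr_right_mult_square_zero: "tr (\<lambda>Y. A (A Y Z) X) = 0"
  by (simp add: tr_right_mult_square unimodular A_lin)

lemma sum_A_A_zero: "(\<Sum>e\<in>E. A (A e Z) e) = 0"
  by (simp add: sum_A_A unimodular A_lin)

lemma parallel_if_symmetric:
  assumes "\<And>Y Z. A Y X \<bullet> Z = Y \<bullet> A Z X" shows "A Y X = 0"
proof (rule sum_squares_zero[OF linear_A(2)])
  show "(\<Sum>e\<in>E. A e X \<bullet> A e X) = 0"
    using tr_square_symmetric[of "\<lambda>Y. A Y X", OF assms] tr_right_mult_square_zero by simp
qed

lemma parallel_if_skew: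
  assumes "\<And>Y Z. A Y X \<bullet> Z = - (Y \<bullet> A Z X)" shows "A Y X = 0"
proof (rule sum_squares_zero[OF linear_A(2)])
  show "(\<Sum>e\<in>E. A e X \<bullet> A e X) = 0"
    using tr_square_skew[of "\<lambda>Y. A Y X", OF assms] tr_right_mult_square_zero by simp
qed

text \<open>As \<open>X \<bullet> [Y, Z] = A Z X \<bullet> Y - A Y X \<bullet> Z\<close>, orthogonality to all brackets is the symmetry of
\<open>Y \<mapsto> A Y X\<close>. This is Bochner's argument: a closed left-invariant 1-form is coclosed by
unimodularity, and harmonic 1-forms are parallel when the Ricci tensor vanishes.\<close>

lemma commutator_ideal_perp_iff_parallel:
  "(\<forall>N\<in>commutator_ideal br. X \<bullet> N = 0) \<longleftrightarrow> (\<forall>Y. A Y X = 0)"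
proof -
  have br_inner: "X \<bullet> br Y Z = A Z X \<bullet> Y - A Y X \<bullet> Z" for Y Z
    using A_skew[of Y X Z] A_skew[of Z X Y] by (simp add: A_torsion_free inner_diff_right)
  show ?thesis
  proof
    assume perp: "\<forall>N\<in>commutator_ideal br. X \<bullet> N = 0"
    have "X \<bullet> br Y Z = 0" for Y Z
      using perp by (auto simp: commutator_ideal_def intro: span_base)
    then have "A Y X \<bullet> Z = Y \<bullet> A Z X" for Y Z
      using br_inner[of Y Z] by (simp add: inner_commute)
    then show "\<forall>Y. A Y X = 0" using parallel_if_symmetric by blast
  next
    assume "\<forall>Y. A Y X = 0"
    then have perp: "X \<bullet> br Y Z = 0" for Y Z by (simp add: br_inner)
    have "X \<bullet> N = 0" if "N \<in> commutator_ideal br" for N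
      using that unfolding commutator_ideal_def
      by (induction rule: span_induct_alt) (auto simp: perp inner_add_right)
    then show "\<forall>N\<in>commutator_ideal br. X \<bullet> N = 0" by blast
  qed
qed

text \<open>For central \<open>X\<close> the map \<open>Y \<mapsto> A Y X\<close> coincides with the skew map \<open>A X\<close>.\<close>

lemma center_parallel:
  assumes "X \<in> lie_center br" shows "A Y X = 0"
proof -
  have "A Y X = A X Y" for Y
    using assms A_torsion_free[of X Y] by (simp add: lie_center_def)
  then show ?thesis by (intro parallel_if_skew) (simp add: A_skew)
qed

end

section \<open>Ricci-flat Kaehler Lie algebras are flat\<close>

text \<open>Contracting the curvature with the Kaehler form, as in the last condition, yields the Ricci form. For
a Kaehler metric its vanishing is equivalent to Ricci-flatness.\<close>

locale ricci_flat_kaehler_lie_algebra = metric_lie_algebra_frame +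
  fixes I :: "'a \<Rightarrow> 'a"
  assumes linear_I: "linear I" and I_square: "I (I X) = - X"
    and I_isometric: "I X \<bullet> I Y = X \<bullet> Y"
    and I_parallel: "A X (I Y) = I (A X Y)"
    and ricci_form: "(\<Sum>e\<in>E. curv e (I e) Z) = 0"
begin

lemmas I_lin = linear_add[OF linear_I] linear_scale[OF linear_I] linear_neg[OF linear_I]
  linear_diff[OF linear_I] linear_0[OF linear_I]

lemma I_skew: "I X \<bullet> Y = - (X \<bullet> I Y)"
  using I_isometric[of "I X" Y] by (simp add: I_square)

lemma sum_I_skew:
  fixes f :: "'a \<Rightarrow> 'a \<Rightarrow> 'b::real_vector"
  assumes "bilinear f" shows "(\<Sum>e\<in>E. f (I e) e) = - (\<Sum>e\<in>E. f e (I e))"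
  by (rule sum_skew[OF assms I_skew])

lemma sum_I_I:
  fixes f :: "'a \<Rightarrow> 'a \<Rightarrow> 'b::real_vector"
  assumes bil: "bilinear f" shows "(\<Sum>e\<in>E. f (I e) (I e)) = (\<Sum>e\<in>E. f e e)"
proof -
  have "bilinear (\<lambda>X Y. f X (I Y))"
    using bil by (simp add: bilinear_def linear_iff I_lin)
  from sum_I_skew[OF this] show ?thesis
    by (simp add: I_square bilinear_rneg[OF bil] sum_negf)
qed

lemma curv_I: "curv X Y (I Z) = I (curv X Y Z)"
  by (simp add: curv_def I_parallel I_lin)

text \<open>The curvature is of type (1,1): by pair symmetry, commuting with \<open>I\<close> as an endomorphism becomes
invariance under \<open>I\<close> in the first two arguments.\<close>

lemma curv_I_I: "curv (I X) (I Y) Z = curv X Y Z"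
proof -
  have "curv (I X) (I Y) Z \<bullet> W = curv X Y Z \<bullet> W" for W
    by (simp add: curv_pair_symmetry[of _ _ Z W] curv_I I_isometric)
  then show ?thesis using vector_eq_rdot by blast
qed

text \<open>The Bianchi identity turns the contraction with the Kaehler form into twice \<open>I\<close> applied to the
Ricci contraction.\<close>

lemma ricci_zero: "(\<Sum>e\<in>E. curv e Z e) = 0"
proof -
  have b: "bilinear (\<lambda>X Y. curv X Z Y)" by (simp add: bilinear_def linear_iff curv_lin)
  have "curv e (I e) Z = curv e Z (I e) - curv (I e) Z e" for e
    using bianchi[of e "I e" Z] curv_antisym[of Z e "I e"]
    by (simp add: algebra_simps eq_neg_iff_add_eq_0)
  then have "(\<Sum>e\<in>E. curv e Z (I e)) - (\<Sum>e\<in>E. curv (I e) Z e) = 0"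
    using ricci_form[of Z] by (simp add: sum_subtractf)
  then have "2 *\<^sub>R (\<Sum>e\<in>E. curv e Z (I e)) = 0"
    using sum_I_skew[OF b] by (simp add: scaleR_2)
  then have "I (\<Sum>e\<in>E. curv e Z e) = 0" by (simp add: curv_I linear_sum[OF linear_I])
  then show ?thesis using I_square by (metis I_lin(5) neg_equal_0_iff_equal)
qed

sublocale ricci_flat_lie_algebra
  by unfold_locales (rule ricci_zero)

text \<open>Expanding \<open>tr (R i j \<circ> R (I i) (I j))\<close> produces traces of products of two, three and four
connection forms. The following lemmas treat the sums of these terms separately.\<close>

definition tr2 where "tr2 X Y = tr (\<lambda>x. A X (A Y x))"
definition tr3 where "tr3 X Y Z = tr (\<lambda>x. A X (A Y (A Z x)))"
definition tr4 where "tr4 X Y Z W = tr (\<lambda>x. A X (A Y (A Z (A W x))))"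

lemma tr3_rotate: "tr3 X Y Z = tr3 Y Z X"
  unfolding tr3_def by (rule tr_cyclic) auto

lemma tr4_rotate: "tr4 X Y Z W = tr4 Y Z W X"
  unfolding tr4_def by (rule tr_cyclic) auto

lemmas tr_A_lin = tr2_def tr3_def tr4_def A_lin I_lin tr_lin

text \<open>The connection terms of the vanishing Ricci form: its remaining part involves \<open>\<Sum> [e, I e]\<close>, which is
twice \<open>I\<close> applied to \<open>\<Sum> A e e\<close> and so is zero by unimodularity.\<close>

lemma sum_A_I_comp: "(\<Sum>e\<in>E. A e (A (I e) x)) = 0" "(\<Sum>e\<in>E. A (I e) (A e x)) = 0"
proof -
  have swap: "(\<Sum>e\<in>E. A (I e) (A e x)) = - (\<Sum>e\<in>E. A e (A (I e) x))"
    by (rule sum_I_skew[of "\<lambda>X Y. A X (A Y x)"]) (simp add: bilinear_def linear_iff A_lin)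
  have "(\<Sum>e\<in>E. br e (I e)) = I (\<Sum>e\<in>E. A e e) - (\<Sum>e\<in>E. A (I e) e)"
    by (simp add: A_torsion_free I_parallel sum_subtractf linear_sum[OF linear_I])
  also have "(\<Sum>e\<in>E. A (I e) e) = - I (\<Sum>e\<in>E. A e e)"
    using sum_I_skew[OF bilinear_A] by (simp add: I_parallel linear_sum[OF linear_I])
  finally have br0: "(\<Sum>e\<in>E. br e (I e)) = 0" by (simp add: unimodular I_lin)
  have "(\<Sum>e\<in>E. curv e (I e) x) =
      (\<Sum>e\<in>E. A e (A (I e) x)) - (\<Sum>e\<in>E. A (I e) (A e x)) - A (\<Sum>e\<in>E. br e (I e)) x"
    by (simp add: curv_def sum_subtractf A_sum)
  then have "2 *\<^sub>R (\<Sum>e\<in>E. A e (A (I e) x)) = 0"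
    using ricci_form[of x] swap br0 by (simp add: scaleR_2 A_lin)
  then show "(\<Sum>e\<in>E. A e (A (I e) x)) = 0" by simp
  with swap show "(\<Sum>e\<in>E. A (I e) (A e x)) = 0" by simp
qed

lemma quartic_adjacent: "(\<Sum>e\<in>E. tr4 X e (I e) Y) = 0"
proof -
  have "(\<Sum>e\<in>E. tr4 X e (I e) Y) = (\<Sum>x\<in>E. A X (\<Sum>e\<in>E. A e (A (I e) (A Y x))) \<bullet> x)"
    unfolding tr4_def tr_def by (subst sum.swap) (simp add: A_sum inner_sum_left)
  then show ?thesis by (simp add: sum_A_I_comp A_lin)
qed

text \<open>Replacing \<open>i\<close> by \<open>I i\<close> changes the sign of the sum, while cyclicity of the trace shows that the
result is the original sum with \<open>i\<close> and \<open>j\<close> exchanged.\<close>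

lemma quartic_alternating: "(\<Sum>i\<in>E. \<Sum>j\<in>E. tr4 i j (I i) (I j)) = 0"
proof -
  have "(\<Sum>i\<in>E. tr4 i j (I i) (I j)) = - (\<Sum>i\<in>E. tr4 (I i) j i (I j))" for j
    using sum_I_skew[of "\<lambda>X Y. tr4 X j Y (I j)"]
    by (simp add: bilinear_def linear_iff tr_A_lin)
  then have "(\<Sum>i\<in>E. \<Sum>j\<in>E. tr4 i j (I i) (I j)) = - (\<Sum>j\<in>E. \<Sum>i\<in>E. tr4 (I i) j i (I j))"
    by (subst sum.swap) (simp add: sum_negf)
  also have "\<dots> = - (\<Sum>j\<in>E. \<Sum>i\<in>E. tr4 j i (I j) (I i))"
    by (simp add: tr4_rotate[of "I _"])
  finally show ?thesis by simp
qed

text \<open>By torsion-freeness this is a difference of two sums. In the first one \<open>I\<close> is moved from one \<open>j\<close> to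
the other, in the second one the skew map \<open>A i\<close> is; both then agree up to a rotation.\<close>

lemma cubic: "(\<Sum>i\<in>E. \<Sum>j\<in>E. tr3 (br i j) (I i) (I j)) = 0"
proof -
  have "(\<Sum>j\<in>E. tr3 (A i j) (I i) (I j)) = - (\<Sum>j\<in>E. tr3 (A i (I j)) (I i) j)" for i
    using sum_I_skew[of "\<lambda>X Y. tr3 (A i X) (I i) Y"]
    by (simp add: bilinear_def linear_iff tr_A_lin)
  moreover have "(\<Sum>j\<in>E. tr3 (A i j) (I j) (I i)) = - (\<Sum>j\<in>E. tr3 j (A i (I j)) (I i))" for i
    using sum_skew[of "\<lambda>X Y. tr3 X (I Y) (I i)", OF _ A_skew[of i]]
    by (simp add: bilinear_def linear_iff tr_A_lin I_parallel)
  moreover have "tr3 j (A i (I j)) (I i) = tr3 (A i (I j)) (I i) j" for i j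
    by (rule tr3_rotate)
  ultimately have "(\<Sum>j\<in>E. tr3 (A i j) (I i) (I j)) = (\<Sum>j\<in>E. tr3 (A i j) (I j) (I i))" for i
    by simp
  then have "(\<Sum>i\<in>E. \<Sum>j\<in>E. tr3 (A i j) (I i) (I j)) = (\<Sum>i\<in>E. \<Sum>j\<in>E. tr3 (A i j) (I j) (I i))"
    by simp
  also have "\<dots> = (\<Sum>i\<in>E. \<Sum>j\<in>E. tr3 (A j i) (I i) (I j))" by (rule sum.swap)
  finally show ?thesis
    by (simp add: A_torsion_free tr_A_lin sum_subtractf)
qed

text \<open>After moving \<open>A i\<close> (respectively \<open>A j\<close>) to the other factor, the two halves of the bracket contain
the contractions \<open>\<Sum> A (I i) (A i j)\<close> and \<open>\<Sum> A (A j X) j\<close>, which vanish by \<open>sum_A_I_comp\<close> and by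
\<open>sum_A_A_zero\<close>.\<close>

lemma quadratic: "(\<Sum>i\<in>E. \<Sum>j\<in>E. tr2 (br i j) (I (A (I i) j))) = 0"
proof -
  have "(\<Sum>j\<in>E. tr2 (A i j) (I (A (I i) j))) = - (\<Sum>j\<in>E. tr2 j (I (A (I i) (A i j))))" for i
    using sum_skew[of "\<lambda>X Y. tr2 X (I (A (I i) Y))", OF _ A_skew[of i]]
    by (simp add: bilinear_def linear_iff tr_A_lin)
  then have "(\<Sum>i\<in>E. \<Sum>j\<in>E. tr2 (A i j) (I (A (I i) j))) =
      - (\<Sum>i\<in>E. \<Sum>j\<in>E. tr2 j (I (A (I i) (A i j))))"
    by (simp add: sum_negf)
  also have "(\<Sum>i\<in>E. \<Sum>j\<in>E. tr2 j (I (A (I i) (A i j)))) =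
      (\<Sum>j\<in>E. \<Sum>i\<in>E. tr2 j (I (A (I i) (A i j))))"
    by (rule sum.swap)
  also have "\<dots> = 0"
  proof (rule sum.neutral, rule ballI)
    fix j
    have l: "linear (\<lambda>X. tr2 j (I X))" by (simp add: linear_iff tr_A_lin)
    show "(\<Sum>i\<in>E. tr2 j (I (A (I i) (A i j)))) = 0"
      using linear_sum[OF l, of "\<lambda>i. A (I i) (A i j)" E]
      by (simp add: sum_A_I_comp linear_0[OF l])
  qed
  finally have 1: "(\<Sum>i\<in>E. \<Sum>j\<in>E. tr2 (A i j) (I (A (I i) j))) = 0" by simp
  have 2: "(\<Sum>i\<in>E. \<Sum>j\<in>E. tr2 (A j i) (I (A (I i) j))) = 0"
  proof -
    have a: "(\<Sum>i\<in>E. tr2 (A j i) (I (A (I i) j))) = - (\<Sum>i\<in>E. tr2 i (I (A (I (A j i)) j)))" for j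
      using sum_skew[of "\<lambda>X Y. tr2 X (I (A (I Y) j))", OF _ A_skew[of j]]
      by (simp add: bilinear_def linear_iff tr_A_lin)
    have l: "linear (\<lambda>X. tr2 i (I X))" for i by (simp add: linear_iff tr_A_lin)
    have "(\<Sum>j\<in>E. A (I (A j i)) j) = 0" for i
      using sum_A_A_zero[of "I i"] by (simp add: I_parallel)
    then have "(\<Sum>j\<in>E. tr2 i (I (A (I (A j i)) j))) = 0" for i
      using linear_sum[OF l, of i "\<lambda>j. A (I (A j i)) j" E] by (simp add: linear_0[OF l])
    then show ?thesis
      by (subst sum.swap) (subst a, simp add: sum_negf, rule trans[OF sum.swap], simp)
  qed
  show ?thesis
    using 1 2 by (simp add: A_torsion_free tr_A_lin sum_subtractf)
qed

text \<open>Up to a factor this is the contraction of \<open>tr (R \<and> R)\<close> with \<open>\<omega> \<and> \<omega>\<close>, whose other terms contain the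
Ricci form or agree with this one. All terms of the expansion reduce to the preceding
lemmas by exchanging \<open>i\<close> with \<open>j\<close> or replacing both by \<open>I i\<close> and \<open>I j\<close>.\<close>

lemma sum_tr_curv_square: "(\<Sum>i\<in>E. \<Sum>j\<in>E. tr (\<lambda>x. curv i j (curv (I i) (I j) x))) = 0"
proof -
  define S where "S f = (\<Sum>i\<in>E. \<Sum>j\<in>E. f i j)" for f :: "'a \<Rightarrow> 'a \<Rightarrow> real"
  have S_lin: "S (\<lambda>i j. f i j + g i j) = S f + S g" "S (\<lambda>i j. f i j - g i j) = S f - S g"
    "S (\<lambda>i j. - f i j) = - S f" for f g
    by (simp_all add: S_def sum.distrib sum_subtractf sum_negf)
  have S_swap: "S (\<lambda>i j. f j i) = S f" for f
    unfolding S_def by (rule sum.swap)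
  have expand: "tr (\<lambda>x. curv X Y (curv V W x)) =
      tr4 X Y V W - tr4 X Y W V - tr4 Y X V W + tr4 Y X W V
      - tr3 X Y (br V W) + tr3 Y X (br V W) - tr3 (br X Y) V W + tr3 (br X Y) W V
      + tr2 (br X Y) (br V W)" for X Y V W
    by (simp add: curv_def tr_A_lin)
  have q1: "S (\<lambda>i j. tr4 i j (I i) (I j)) = 0" unfolding S_def by (rule quartic_alternating)
  have q2: "S (\<lambda>i j. tr4 i j (I j) (I i)) = 0" by (simp add: S_def quartic_adjacent)
  have q3: "S (\<lambda>i j. tr4 j i (I i) (I j)) = 0" using S_swap[of "\<lambda>i j. tr4 i j (I j) (I i)"] q2 by simp
  have q4: "S (\<lambda>i j. tr4 j i (I j) (I i)) = 0" using S_swap[of "\<lambda>i j. tr4 i j (I i) (I j)"] q1 by simp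
  have c1: "S (\<lambda>i j. tr3 (br i j) (I i) (I j)) = 0" unfolding S_def by (rule cubic)
  have c2: "S (\<lambda>i j. tr3 (br i j) (I j) (I i)) = 0"
  proof -
    have "S (\<lambda>i j. tr3 (br i j) (I j) (I i)) = S (\<lambda>i j. tr3 (br j i) (I i) (I j))"
      by (rule S_swap)
    also have "\<dots> = - S (\<lambda>i j. tr3 (br i j) (I i) (I j))"
    proof -
      have "tr3 (br j i) (I i) (I j) = - tr3 (br i j) (I i) (I j)" for i j
        by (subst br_skew) (simp add: tr_A_lin)
      then show ?thesis by (simp only: S_lin)
    qed
    finally show ?thesis using c1 by simp
  qed
  have c3: "S (\<lambda>i j. tr3 i j (br (I i) (I j))) = 0"
  proof -
    have "(\<Sum>j\<in>E. tr3 i j (br (I i) (I j))) = (\<Sum>j\<in>E. tr3 i (I j) (br (I i) (I (I j))))" for i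
      by (rule sum_I_I[of "\<lambda>X Y. tr3 i X (br (I i) (I Y))", symmetric])
        (simp add: bilinear_def linear_iff tr_A_lin br_lin)
    then have "S (\<lambda>i j. tr3 i j (br (I i) (I j))) = - S (\<lambda>i j. tr3 i (I j) (br (I i) j))"
      by (simp add: S_def I_square br_lin tr_A_lin sum_negf)
    also have "S (\<lambda>i j. tr3 i (I j) (br (I i) j)) = S (\<lambda>j i. tr3 i (I j) (br (I i) j))"
      by (rule S_swap)
    also have "(\<Sum>i\<in>E. tr3 i (I j) (br (I i) j)) = (\<Sum>i\<in>E. tr3 (I i) (I j) (br (I (I i)) j))" for j
      by (rule sum_I_I[of "\<lambda>X Y. tr3 X (I j) (br (I Y) j)", symmetric])
        (simp add: bilinear_def linear_iff tr_A_lin br_lin)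
    then have "S (\<lambda>j i. tr3 i (I j) (br (I i) j)) = - S (\<lambda>j i. tr3 (I i) (I j) (br i j))"
      by (simp add: S_def I_square br_lin tr_A_lin sum_negf)
    also have "S (\<lambda>j i. tr3 (I i) (I j) (br i j)) = S (\<lambda>i j. tr3 (I i) (I j) (br i j))"
      by (rule S_swap)
    also have "\<dots> = 0" using c1 by (simp add: tr3_rotate[of "br _ _"])
    finally show ?thesis by simp
  qed
  have c4: "S (\<lambda>i j. tr3 j i (br (I i) (I j))) = 0"
  proof -
    have "S (\<lambda>i j. tr3 j i (br (I i) (I j))) = S (\<lambda>i j. tr3 i j (br (I j) (I i)))"
      by (rule S_swap)
    also have "\<dots> = - S (\<lambda>i j. tr3 i j (br (I i) (I j)))"
    proof -
      have "tr3 i j (br (I j) (I i)) = - tr3 i j (br (I i) (I j))" for i j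
        by (subst br_skew) (simp add: tr_A_lin)
      then show ?thesis by (simp only: S_lin)
    qed
    finally show ?thesis using c3 by simp
  qed
  have t1: "S (\<lambda>i j. tr2 (br i j) (I (A (I i) j))) = 0" unfolding S_def by (rule quadratic)
  have t2: "S (\<lambda>i j. tr2 (br i j) (I (A (I j) i))) = 0"
  proof -
    have "S (\<lambda>i j. tr2 (br i j) (I (A (I j) i))) = S (\<lambda>i j. tr2 (br j i) (I (A (I i) j)))"
      by (rule S_swap)
    also have "\<dots> = - S (\<lambda>i j. tr2 (br i j) (I (A (I i) j)))"
    proof -
      have "tr2 (br j i) (I (A (I i) j)) = - tr2 (br i j) (I (A (I i) j))" for i j
        by (subst br_skew) (simp add: tr_A_lin)
      then show ?thesis by (simp only: S_lin)
    qed
    finally show ?thesis using t1 by simp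
  qed
  \<comment> \<open>\<open>I\<close> being parallel, the last bracket again splits into two halves\<close>
  have br_I: "br (I i) (I j) = I (A (I i) j) - I (A (I j) i)" for i j
    by (simp add: A_torsion_free I_parallel)
  have t: "S (\<lambda>i j. tr2 (br i j) (br (I i) (I j))) = 0"
    using t1 t2 by (simp add: br_I tr_A_lin S_lin)
  have "S (\<lambda>i j. tr (\<lambda>x. curv i j (curv (I i) (I j) x))) = 0"
    unfolding expand S_lin by (simp add: q1 q2 q3 q4 c1 c2 c3 c4 t)
  then show ?thesis by (simp add: S_def)
qed

text \<open>By \<open>curv_I_I\<close> the preceding sum is \<open>- |R|\<^sup>2\<close>.\<close>

theorem curvature_vanishes: "curv X Y Z = 0"
proof -
  have lin: "linear (curv X Y)" for X Y by (simp add: linear_iff curv_lin)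
  have "tr (\<lambda>x. curv i j (curv (I i) (I j) x)) = - (\<Sum>e\<in>E. curv i j e \<bullet> curv i j e)" for i j
    using tr_square_skew[of "curv i j", OF curv_skew] by (simp add: curv_I_I)
  then have "(\<Sum>i\<in>E. \<Sum>j\<in>E. \<Sum>e\<in>E. curv i j e \<bullet> curv i j e) = 0"
    using sum_tr_curv_square by (simp add: sum_negf)
  then have "\<forall>i\<in>E. (\<Sum>j\<in>E. \<Sum>e\<in>E. curv i j e \<bullet> curv i j e) = 0"
    using finite_E by (subst (asm) sum_nonneg_eq_0_iff) (auto intro!: sum_nonneg)
  then have "\<forall>i\<in>E. \<forall>j\<in>E. (\<Sum>e\<in>E. curv i j e \<bullet> curv i j e) = 0"
    using finite_E by (subst (asm) sum_nonneg_eq_0_iff) (auto intro!: sum_nonneg)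
  then have 0: "curv i j Z = 0" if "i \<in> E" "j \<in> E" for i j
    using that sum_squares_zero[OF lin] by blast
  have "curv i Y Z = 0" if "i \<in> E" for i
    by (rule linear_zero_on_frame[of "\<lambda>Y. curv i Y Z"]) (simp_all add: linear_iff curv_lin 0 that)
  then show ?thesis
    by - (rule linear_zero_on_frame[of "\<lambda>X. curv X Y Z"], simp_all add: linear_iff curv_lin)
qed

end

section \<open>Flat metric Lie algebras\<close>

locale flat_metric_lie_algebra = metric_lie_algebra_frame +
  assumes flat: "curv X Y Z = 0"
begin

sublocale ricci_flat_lie_algebra
  by unfold_locales (simp add: flat)

text \<open>Because \<open>A X\<close> is skew this is the invariant trace form \<open>- tr (A X \<circ> A Y)\<close>; the sum of inner products
exhibits it as positive semidefinite.\<close>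

definition A_form :: "'a \<Rightarrow> 'a \<Rightarrow> real" where
  "A_form X Y = (\<Sum>e\<in>E. A X e \<bullet> A Y e)"

lemma A_br: "A (br X Y) Z = A X (A Y Z) - A Y (A X Z)"
  using flat[of X Y Z] by (simp add: curv_def)

lemma bilinear_A_form: "bilinear A_form"
  by (simp add: bilinear_def linear_iff A_form_def A_lin inner_add_left inner_add_right
      sum.distrib sum_distrib_left)

lemma A_form_commute: "A_form X Y = A_form Y X"
  by (simp add: A_form_def inner_commute)

lemma A_form_null: "A_form X X = 0 \<Longrightarrow> A X Z = 0"
  unfolding A_form_def by (rule sum_squares_zero[OF linear_A(1)])

lemma A_form_invariant: "A_form (br Z X) Y = - A_form X (br Z Y)"
proof -
  have tr: "A_form X Y = - tr (\<lambda>x. A X (A Y x))" for X Y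
    unfolding A_form_def tr_def sum_negf[symmetric]
    by (intro sum.cong refl) (subst A_skew, simp add: inner_commute)
  have "tr (\<lambda>x. A Z (A X (A Y x))) = tr (\<lambda>x. A X (A Y (A Z x)))"
    by (rule tr_cyclic) auto
  then show ?thesis by (simp add: tr A_br A_lin tr_lin)
qed

text \<open>The Casimir argument from the introduction. It takes the place of the structure theory of compact
Lie algebras in the classical treatment of flat left-invariant metrics.\<close>

theorem A_commutator_ideal_zero:
  assumes N: "N \<in> commutator_ideal br" shows "A N Z = 0"
proof -
  define U where "U = {X. \<forall>Z. A X Z = 0}"
  define W where "W = {X. \<forall>Y\<in>U. X \<bullet> Y = 0}"
  have sub_U: "subspace U" by (simp add: U_def subspace_def A_lin)
  have sub_W: "subspace W" by (simp add: W_def subspace_def inner_add_left)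
  have UW: "X = 0" if "X \<in> U" "X \<in> W" for X using that by (auto simp: W_def)
  have A_U: "A X Y \<in> U" if "Y \<in> U" for X Y
  proof -
    have "br X Y = A X Y" using that by (simp add: A_torsion_free U_def)
    then show ?thesis using A_br[of X Y] that by (simp add: U_def A_lin)
  qed
  have A_W: "A X Y \<in> W" if "Y \<in> W" for X Y
    using A_U that by (simp add: W_def A_skew)
  have split: "\<exists>u w. X = u + w \<and> u \<in> U \<and> w \<in> W" for X
  proof -
    obtain u w where "X = u + w" "u \<in> U" "\<forall>Y\<in>U. w \<bullet> Y = 0"
      using orthogonal_decomposition[OF finite_dim sub_U] .
    then show ?thesis by (auto simp: W_def)
  qed
  obtain B where B: "finite B" "span B = W" using finite_dim_subspace_spanned[OF finite_dim sub_W] .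
  obtain F where F: "finite F" "F \<subseteq> W"
    and ex: "\<forall>X\<in>W. \<forall>Y. A_form X Y = (\<Sum>f\<in>F. A_form X f * A_form f Y)"
  proof -
    have "\<exists>F. finite F \<and> F \<subseteq> span B \<and>
        (\<forall>X\<in>span B. \<forall>Y. A_form X Y = (\<Sum>f\<in>F. A_form X f * A_form f Y))"
      using bilinear_A_form A_form_commute _ _ B(1)
    proof (rule semi_inner_frame_exists)
      show "A_form X X \<ge> 0" for X by (simp add: A_form_def sum_nonneg)
      show "A_form X Y = 0" if "A_form X X = 0" for X Y
        using A_form_null[OF that] by (simp add: A_form_def)
    qed
    then show ?thesis using that unfolding B(2) by metis
  qed
  have exp_W: "(\<Sum>f\<in>F. A_form X f *\<^sub>R f) = X" if "X \<in> W" for X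
  proof -
    define D where "D = X - (\<Sum>f\<in>F. A_form X f *\<^sub>R f)"
    have l: "linear (\<lambda>X. A_form X Y)" for Y using bilinear_A_form by (simp add: bilinear_def)
    have "A_form D D = A_form X D - (\<Sum>f\<in>F. A_form X f * A_form f D)"
      by (subst D_def) (simp add: linear_diff[OF l] linear_sum[OF l] linear_scale[OF l])
    also have "\<dots> = 0" using ex[rule_format, OF that, of D] by (simp only: diff_self)
    finally have "D \<in> U" using A_form_null by (simp add: U_def)
    moreover have "D \<in> W"
      unfolding D_def using sub_W F(2) that
      by (auto intro!: subspace_diff subspace_sum subspace_scale)
    ultimately have "D = 0" by (rule UW)
    then show ?thesis by (simp add: D_def)
  qed
  define p where "p = (\<Sum>f\<in>F. A f f)"
  have p_W: "p \<in> W" unfolding p_def using sub_W A_W F(2) by (auto intro!: subspace_sum)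
  \<comment> \<open>\<open>A Y\<close> is moved past \<open>A f\<close>; the commutator terms cancel since \<open>ad Y\<close> is skew for the trace form\<close>
  have casimir: "A Y p = (\<Sum>f\<in>F. A f (A f Y))" if Y: "Y \<in> W" for Y
  proof -
    have br_W: "br Y f = (\<Sum>g\<in>F. A_form (br Y f) g *\<^sub>R g)" if "f \<in> F" for f
    proof -
      have "br Y f \<in> W"
        by (subst A_torsion_free) (intro subspace_diff[OF sub_W] A_W Y subsetD[OF F(2) that])
      then show ?thesis by (rule exp_W[symmetric])
    qed
    have left: "A (br Y f) f = (\<Sum>g\<in>F. A_form (br Y f) g *\<^sub>R A g f)"
      and right: "A f (br Y f) = (\<Sum>g\<in>F. A_form (br Y f) g *\<^sub>R A f g)" if "f \<in> F" for f
      using arg_cong[OF br_W[OF that], of "\<lambda>X. A X f"] arg_cong[OF br_W[OF that], of "A f"]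
      by (simp_all add: A_sum A_lin)
    have "(\<Sum>f\<in>F. A (br Y f) f) = (\<Sum>f\<in>F. \<Sum>g\<in>F. A_form (br Y f) g *\<^sub>R A g f)"
      by (intro sum.cong refl left)
    also have "\<dots> = (\<Sum>g\<in>F. \<Sum>f\<in>F. A_form (br Y f) g *\<^sub>R A g f)" by (rule sum.swap)
    also have "\<dots> = (\<Sum>g\<in>F. - (\<Sum>f\<in>F. A_form (br Y g) f *\<^sub>R A g f))"
    proof (intro sum.cong refl)
      fix g
      have "A_form (br Y f) g = - A_form (br Y g) f" for f
        using A_form_invariant[of Y f g] A_form_commute[of f] by simp
      then show "(\<Sum>f\<in>F. A_form (br Y f) g *\<^sub>R A g f) = - (\<Sum>f\<in>F. A_form (br Y g) f *\<^sub>R A g f)"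
        by (simp add: sum_negf)
    qed
    also have "\<dots> = - (\<Sum>g\<in>F. A g (br Y g))"
      unfolding sum_negf by (intro arg_cong[of _ _ uminus] sum.cong refl right[symmetric])
    finally have cancel: "(\<Sum>f\<in>F. A (br Y f) f) + (\<Sum>f\<in>F. A f (br Y f)) = 0" by simp
    have "A Y (A f f) = A (br Y f) f + A f (br Y f) + A f (A f Y)" for f
      using A_br[of Y f f] by (simp add: A_torsion_free A_lin algebra_simps)
    then show ?thesis using cancel by (simp add: p_def A_sum sum.distrib)
  qed
  obtain u w where uw: "\<And>X. X = u X + w X" "\<And>X. u X \<in> U" "\<And>X. w X \<in> W"
    using split by metis
  \<comment> \<open>only the \<open>W\<close>-parts of \<open>e\<close> contribute, since \<open>U\<close> acts trivially and \<open>A X p\<close> is in \<open>W\<close>\<close>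
  have tr_term: "A e p \<bullet> e = - (\<Sum>f\<in>F. A f (w e) \<bullet> A f (w e))" for e
  proof -
    have "A e p = A (w e) p"
      using arg_cong[OF uw(1)[of e], of "\<lambda>X. A X p"] uw(2)[of e] by (simp add: A_lin U_def)
    moreover have "A (w e) p \<bullet> e = A (w e) p \<bullet> w e"
    proof -
      have "A (w e) p \<bullet> u e = 0" using A_W[OF p_W, of "w e"] uw(2)[of e] by (simp add: W_def)
      then show ?thesis using arg_cong[OF uw(1)[of e], of "\<lambda>X. A (w e) p \<bullet> X"]
        by (simp add: inner_add_right)
    qed
    ultimately have "A e p \<bullet> e = (\<Sum>f\<in>F. A f (A f (w e))) \<bullet> w e"
      using casimir[OF uw(3)[of e]] by simp
    also have "\<dots> = - (\<Sum>f\<in>F. A f (w e) \<bullet> A f (w e))"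
      by (simp add: inner_sum_left A_skew[of _ "A _ (w e)"] sum_negf)
    finally show ?thesis .
  qed
  have "(\<Sum>e\<in>E. \<Sum>f\<in>F. A f (w e) \<bullet> A f (w e)) = 0"
    using tr_right_mult_zero[of p] by (simp add: tr_def tr_term sum_negf)
  then have "\<forall>e\<in>E. (\<Sum>f\<in>F. A f (w e) \<bullet> A f (w e)) = 0"
    using finite_E by (subst (asm) sum_nonneg_eq_0_iff) (auto intro!: sum_nonneg)
  then have A_w: "A f (w e) = 0" if "e \<in> E" "f \<in> F" for e f
    using that F(1) by (simp add: sum_nonneg_eq_0_iff)
  have parallel: "A X Y = 0" if Y: "Y \<in> W" for X Y
  proof -
    have "Y = (\<Sum>e\<in>E. (Y \<bullet> e) *\<^sub>R u e) + (\<Sum>e\<in>E. (Y \<bullet> e) *\<^sub>R w e)"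
      unfolding sum.distrib[symmetric] scaleR_add_right[symmetric] uw(1)[symmetric]
      by (rule expansion[symmetric])
    moreover have "(\<Sum>e\<in>E. (Y \<bullet> e) *\<^sub>R w e) \<in> W" "(\<Sum>e\<in>E. (Y \<bullet> e) *\<^sub>R u e) \<in> U"
      using sub_U sub_W uw(2,3) by (auto intro!: subspace_sum subspace_scale)
    ultimately have Y_eq: "Y = (\<Sum>e\<in>E. (Y \<bullet> e) *\<^sub>R w e)"
      using UW Y sub_W by (metis (no_types, lifting) add_diff_cancel_right' add_0 subspace_diff)
    have f0: "A f Y = 0" if "f \<in> F" for f
      by (subst Y_eq) (simp add: A_sum A_lin A_w that)
    have "A X Y = A (w X) Y"
      using arg_cong[OF uw(1)[of X], of "\<lambda>X. A X Y"] uw(2)[of X] by (simp add: A_lin U_def)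
    also have "\<dots> = A (\<Sum>f\<in>F. A_form (w X) f *\<^sub>R f) Y" by (simp only: exp_W[OF uw(3)])
    also have "\<dots> = 0" by (simp add: A_sum A_lin f0)
    finally show ?thesis .
  qed
  have "w N \<bullet> N = 0"
    using commutator_ideal_perp_iff_parallel[of "w N"] parallel[OF uw(3)] N by blast
  moreover have "w N \<bullet> u N = 0" using uw(2,3)[of N] by (simp add: W_def)
  ultimately have "w N \<bullet> w N = 0"
    using arg_cong[OF uw(1)[of N], of "\<lambda>X. w N \<bullet> X"] by (simp add: inner_add_right)
  then have "N = u N" using uw(1)[of N] by simp
  then show ?thesis using uw(2)[of N] by (simp add: U_def)
qed

end

section \<open>Hyper-Kaehler Lie algebras\<close>

locale hyper_kaehler_frame = hyper_kaehler_lie_algebra br J + metric_lie_algebra_frame br E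
  for br :: "'a::real_inner \<Rightarrow> 'a \<Rightarrow> 'a" and J :: "nat \<Rightarrow> 'a \<Rightarrow> 'a" and E :: "'a set"
begin

lemma A_J: "\<alpha> \<in> {1, 2, 3} \<Longrightarrow> A X (J \<alpha> Y) = J \<alpha> (A X Y)"
  using J_parallel by simp

lemma curv_J:
  assumes "\<alpha> \<in> {1, 2, 3}" shows "curv X Y (J \<alpha> Z) = J \<alpha> (curv X Y Z)"
  by (simp add: curv_def A_J[OF assms] linear_diff[OF linear_J[OF assms]])

lemma J_skew:
  assumes "\<alpha> \<in> {1, 2, 3}" shows "J \<alpha> X \<bullet> Y = - (X \<bullet> J \<alpha> Y)"
  using J_isometric[OF assms, of "J \<alpha> X" Y] by (simp add: J_square[OF assms])

text \<open>The curvature commutes with \<open>J\<^sub>1\<close> and \<open>J\<^sub>2\<close>, which anticommute with each other.\<close>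

lemma tr_J_curv: "tr (\<lambda>x. J 1 (curv X Y x)) = 0"
proof (rule tr_zero_if_anticommuting)
  have lin: "linear (J 1)" by (rule linear_J) simp
  show "linear (\<lambda>x. J 1 (curv X Y x))"
    unfolding linear_iff by (simp only: curv_lin linear_add[OF lin] linear_scale[OF lin]) simp
  show "linear (J 2)" by (simp add: linear_J)
  show "J 2 (J 2 x) = - x" "J 2 x \<bullet> y = - (x \<bullet> J 2 y)" for x y
    by (simp_all add: J_square J_skew)
  show "J 1 (curv X Y (J 2 x)) = - J 2 (J 1 (curv X Y x))" for x
    by (simp only: curv_J[of 2, simplified] J1_J2 J2_J1)
qed

sublocale ricci_flat_kaehler_lie_algebra br E "J 1"
proof unfold_locales
  have lin: "linear (J 1)" by (rule linear_J) simp
  show "J 1 (X + Y) = J 1 X + J 1 Y" "J 1 (c *\<^sub>R X) = c *\<^sub>R J 1 X" for X Y c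
    by (simp_all only: linear_add[OF lin] linear_scale[OF lin])
  show "J 1 (J 1 X) = - X" for X by (rule J_square) simp
  show "J 1 X \<bullet> J 1 Y = X \<bullet> Y" for X Y by (rule J_isometric) simp
  show "A X (J 1 Y) = J 1 (A X Y)" for X Y by (rule A_J) simp
  show "(\<Sum>e\<in>E. curv e (J 1 e) Z) = 0" for Z
  proof -
    have "curv e (J 1 e) Z \<bullet> W = - (J 1 (curv Z W e) \<bullet> e)" for e W
      using J_skew[of 1 "curv Z W e" e] by (simp add: curv_pair_symmetry[of e _ Z W])
    then have "(\<Sum>e\<in>E. curv e (J 1 e) Z) \<bullet> W = 0 \<bullet> W" for W
      using tr_J_curv[of Z W] by (simp add: inner_sum_left tr_def sum_negf)
    then show ?thesis using vector_eq_rdot by blast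
  qed
qed

sublocale flat_metric_lie_algebra br E
  by unfold_locales (rule curvature_vanishes)

end

theorem proposition3p1:
  fixes br :: "'a::real_inner \<Rightarrow> 'a \<Rightarrow> 'a" and J :: "nat \<Rightarrow> 'a \<Rightarrow> 'a"
  assumes "hyper_kaehler_lie_algebra br J"
  shows "\<exists>\<tt>. subspace \<tt>
    \<and> {X + Y | X Y. X \<in> \<tt> \<and> Y \<in> commutator_ideal br} = UNIV
    \<and> \<tt> \<inter> commutator_ideal br = {0}
    \<and> (\<forall>X\<in>\<tt>. \<forall>Y\<in>commutator_ideal br. orthogonal X Y)
    \<and> lie_center br \<subseteq> \<tt>
    \<and> abelian_on br \<tt> \<and> abelian_on br (commutator_ideal br)
    \<and> (\<forall>\<alpha>\<in>{1, 2, 3}. J \<alpha> ` \<tt> \<subseteq> \<tt> \<and> J \<alpha> ` commutator_ideal br \<subseteq> commutator_ideal br)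
    \<and> (\<forall>X\<in>\<tt>. \<forall>\<alpha>\<in>{1, 2, 3}. \<forall>Y. br X (J \<alpha> Y) = J \<alpha> (br X Y))
    \<and> (\<forall>X\<in>\<tt>. \<forall>Y Z. br X Y \<bullet> Z + Y \<bullet> br X Z = 0)"
proof -
  interpret hyper_kaehler_lie_algebra br J by fact
  obtain E :: "'a set" where E: "finite E"
    and parseval: "\<forall>x\<in>UNIV. \<forall>y. x \<bullet> y = (\<Sum>e\<in>E. (x \<bullet> e) * (e \<bullet> y))"
    by (rule parseval_frame_exists[OF finite_dim subspace_UNIV])
  interpret parseval_frame E
  proof
    show "finite E" by (rule E)
    show "x \<bullet> y = (\<Sum>e\<in>E. (x \<bullet> e) * (e \<bullet> y))" for x y by (rule parseval[rule_format, OF UNIV_I])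
  qed
  interpret hyper_kaehler_frame br J E ..
  define T where "T = {X. \<forall>Y. A Y X = 0}"
  have sub_N: "subspace (commutator_ideal br)" by (simp add: commutator_ideal_def)
  have perp: "X \<in> T \<longleftrightarrow> (\<forall>N\<in>commutator_ideal br. X \<bullet> N = 0)" for X
    by (simp add: T_def commutator_ideal_perp_iff_parallel)
  have ad: "br X Y = A X Y" if "X \<in> T" for X Y
    using that by (simp add: A_torsion_free T_def)
  have split: "\<exists>n t. X = n + t \<and> n \<in> commutator_ideal br \<and> t \<in> T" for X
  proof -
    obtain n t where "X = n + t" "n \<in> commutator_ideal br" "\<forall>N\<in>commutator_ideal br. t \<bullet> N = 0"
      using orthogonal_decomposition[OF finite_dim sub_N] .
    then show ?thesis using perp by blast
  qed
  have J_T: "J \<alpha> X \<in> T" if "\<alpha> \<in> {1, 2, 3}" "X \<in> T" for \<alpha> X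
    using that by (simp add: T_def A_J linear_0[OF linear_J[OF that(1)]])
  have J_N: "J \<alpha> N \<in> commutator_ideal br" if \<alpha>: "\<alpha> \<in> {1, 2, 3}" and N: "N \<in> commutator_ideal br" for \<alpha> N
  proof -
    obtain n t where nt: "J \<alpha> N = n + t" "n \<in> commutator_ideal br" "t \<in> T" using split by blast
    have "t \<bullet> J \<alpha> N = 0"
      using J_T[OF \<alpha> nt(3)] J_skew[OF \<alpha>, of t N] N by (simp add: perp)
    moreover have "t \<bullet> n = 0" using nt by (simp add: perp)
    ultimately have "t \<bullet> t = 0" by (simp add: nt(1) inner_add_right)
    then show ?thesis using nt by simp
  qed
  show ?thesis
  proof (rule exI[of _ T], intro conjI)
    show "subspace T" by (simp add: T_def subspace_def A_lin)
    show "{X + Y | X Y. X \<in> T \<and> Y \<in> commutator_ideal br} = UNIV"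
    proof -
      have "\<exists>t n. X = t + n \<and> t \<in> T \<and> n \<in> commutator_ideal br" for X
        using split[of X] add.commute by metis
      then show ?thesis by blast
    qed
    show "T \<inter> commutator_ideal br = {0}"
    proof
      show "T \<inter> commutator_ideal br \<subseteq> {0}" using perp inner_eq_zero_iff by blast
      show "{0} \<subseteq> T \<inter> commutator_ideal br" using subspace_0[OF sub_N] perp by simp
    qed
    show "\<forall>X\<in>T. \<forall>Y\<in>commutator_ideal br. orthogonal X Y"
      using perp by (simp add: orthogonal_def)
    show "lie_center br \<subseteq> T" using center_parallel by (auto simp: T_def)
    show "abelian_on br T" unfolding abelian_on_def using ad by (simp add: T_def)
    show "abelian_on br (commutator_ideal br)"
      unfolding abelian_on_def using A_commutator_ideal_zero by (simp add: A_torsion_free)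
    show "\<forall>\<alpha>\<in>{1, 2, 3}. J \<alpha> ` T \<subseteq> T \<and> J \<alpha> ` commutator_ideal br \<subseteq> commutator_ideal br"
      using J_T J_N by blast
    show "\<forall>X\<in>T. \<forall>\<alpha>\<in>{1, 2, 3}. \<forall>Y. br X (J \<alpha> Y) = J \<alpha> (br X Y)" using ad A_J by simp
    show "\<forall>X\<in>T. \<forall>Y Z. br X Y \<bullet> Z + Y \<bullet> br X Z = 0" using ad by (simp add: A_skew)
  qed
qed

end
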